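(* For every integer $k\ge1$, $$E^{k(k-1)\cdots1}_{1\text{-}23}(x)=E^{k(k-1)\cdots1}_{1\text{-}32}(x)=\begin{cases}\dfrac{e^{e^x}}{(k-1)!}\displaystyle\int_0^x t^{k-1}e^{-e^t+t}\,dt,&\text{if }k\ge2,\\[2mm] e^{e^x-1},&\text{if }k=1.\end{cases}$$
   Context: For a permutation $abc$ of $\{1,2,3\}$, a permutation $\pi=\pi_1\cdots\pi_n$ of $\{1,\dots,n\}$ contains the generalized pattern $a\text{-}bc$ if there are indices $i<j<n$ such that $\pi_i\pi_j\pi_{j+1}$ is order-isomorphic to $abc$; otherwise it avoids it. A permutation $\pi$ begins with a pattern $p=p_1\cdots p_k$ if $n\ge k$ and $\pi_1\cdots\pi_k$ is order-isomorphic to $p$; by convention, the empty permutation is also regarded as beginning with the pattern $1$ (the case $k=1$). $E^p_q(x)=\sum_{n\ge0}N^p_q(n)\frac{x^n}{n!}$, where $N^p_q(n)$ is the number of permutations of $\{1,\dots,n\}$ that avoid $q$ and begin with $p$. Identities are identities of power series in $x$. *)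

theory Defs
  imports "HOL-Analysis.Analysis" "HOL-Combinatorics.Multiset_Permutations"
begin

definition order_isomorphic :: "nat list \<Rightarrow> nat list \<Rightarrow> bool" where
  "order_isomorphic xs ys \<longleftrightarrow> length xs = length ys \<and>
     (\<forall>i < length xs. \<forall>j < length xs. xs ! i < xs ! j \<longleftrightarrow> ys ! i < ys ! j)"

text \<open>
  Permutations are lists in one-line notation. The list \<open>[a, b, c]\<close> stands for the generalized
  pattern \<open>a-bc\<close>: the last two letters of an occurrence must be adjacent, the first one is
  anywhere to their left.
\<close>

definition contains_gen :: "nat list \<Rightarrow> nat list \<Rightarrow> bool" where
  "contains_gen q xs \<longleftrightarrow>
     (\<exists>i j. i < j \<and> Suc j < length xs \<and> order_isomorphic [xs ! i, xs ! j, xs ! Suc j] q)"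

text \<open>The second disjunct is the convention that the empty permutation begins with \<open>1\<close>.\<close>

definition begins_with :: "nat list \<Rightarrow> nat list \<Rightarrow> bool" where
  "begins_with p xs \<longleftrightarrow>
     (length p \<le> length xs \<and> order_isomorphic (take (length p) xs) p) \<or> (xs = [] \<and> p = [1])"

definition num_avoiding :: "nat list \<Rightarrow> nat list \<Rightarrow> nat \<Rightarrow> nat" where
  "num_avoiding p q n =
     card {xs \<in> permutations_of_set {1..n}. \<not> contains_gen q xs \<and> begins_with p xs}"

definition egf_avoiding :: "nat list \<Rightarrow> nat list \<Rightarrow> real fps" where
  "egf_avoiding p q = Abs_fps (\<lambda>n. real (num_avoiding p q n) / fact n)"

text \<open>
  The exponential of an arbitrary real power series \<open>F\<close>. The library's composition \<open>oo\<close> is only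
  meaningful if the inner series has zero constant term, so the constant term \<open>c\<close> of \<open>F\<close> is split
  off: \<open>exp F = exp c * exp (F - c)\<close>.
\<close>

definition exp_fps :: "real fps \<Rightarrow> real fps" where
  "exp_fps F = fps_const (exp (fps_nth F 0)) * (fps_exp 1 oo (F - fps_const (fps_nth F 0)))"

lemma exp_fps_nth_0: "fps_nth (exp_fps F) 0 = exp (fps_nth F 0)"
  by (simp add: exp_fps_def)

lemma fps_deriv_exp_fps: "fps_deriv (exp_fps F) = fps_deriv F * exp_fps F"
proof -
  let ?G = "F - fps_const (fps_nth F 0)"
  have "fps_deriv (fps_exp 1 oo ?G) = (fps_deriv (fps_exp 1) oo ?G) * fps_deriv ?G"
    by (rule fps_compose_deriv) simp
  then show ?thesis
    by (simp add: exp_fps_def algebra_simps)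
qed

lemma exp_fps_add: "exp_fps (F + G) = exp_fps F * exp_fps G"
proof -
  let ?H = "F + G"
  have *: "A = B"
    if "fps_nth A 0 = fps_nth B 0" "fps_deriv A = D * A" "fps_deriv B = D * B"
    for A B D :: "real fps"
  proof -
    have "fps_nth A n = fps_nth B n" for n
    proof (induction n rule: less_induct)
      case (less n)
      show ?case
      proof (cases n)
        case 0
        then show ?thesis using that(1) by simp
      next
        case (Suc m)
        have "fps_nth (D * A) m = fps_nth (D * B) m"
          unfolding fps_mult_nth using less Suc by (intro sum.cong) auto
        then have "fps_nth (fps_deriv A) m = fps_nth (fps_deriv B) m"
          using that(2,3) by simp
        then show ?thesis using Suc by simp
      qed
    qed
    then show ?thesis by (simp add: fps_eq_iff)
  qed
  show ?thesis
    by (rule *[where D = "fps_deriv ?H"])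
       (simp_all add: exp_fps_nth_0 fps_deriv_exp_fps exp_add algebra_simps)
qed

lemma exp_fps_X: "exp_fps fps_X = fps_exp 1"
  by (simp add: exp_fps_def)

end

theory Submission
  imports Defs
begin

text \<open>
  Split a permutation at its minimum as \<open>\<sigma> m \<tau>\<close>. It avoids \<open>1-23\<close> (resp. \<open>1-32\<close>) iff \<open>\<sigma>\<close> does and
  \<open>\<tau>\<close> is decreasing (resp. increasing), so \<open>\<tau>\<close> is determined by its set of letters. It begins with
  \<open>k\<dots>1\<close> iff \<open>\<sigma>\<close> does, or \<open>\<sigma>\<close> is decreasing of length \<open>k - 1\<close>. Hence, apart from the convention on
  the empty permutation, both generating functions satisfy
  \<open>G' = e\<^sup>x (G + x\<^sup>k\<^sup>-\<^sup>1 / (k - 1)!)\<close> with \<open>G(0) = 0\<close>, which the integrating factor \<open>exp (- e\<^sup>x)\<close> solves.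
\<close>

section \<open>Avoidance and the minimum letter\<close>

text \<open>
  Avoidance of \<open>1-23\<close> for \<open>Q = (\<ge>)\<close> and of \<open>1-32\<close> for \<open>Q = (\<le>)\<close>: after each letter \<open>x\<close>,
  adjacent letters above \<open>x\<close> are ordered by \<open>Q\<close>.
\<close>

fun avoids :: "(nat \<Rightarrow> nat \<Rightarrow> bool) \<Rightarrow> nat list \<Rightarrow> bool" where
  "avoids Q [] \<longleftrightarrow> True"
| "avoids Q (x # xs) \<longleftrightarrow> successively (\<lambda>y z. x < y \<longrightarrow> x < z \<longrightarrow> Q y z) xs \<and> avoids Q xs"

text \<open>Peeling off the first letter separates the index \<open>i = 0\<close> from the positive
  ones. This links the recursive predicate to occurrences given by indices.\<close>

lemma avoids_iff_nth:
  "avoids Q xs \<longleftrightarrow>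
     (\<forall>i j. i < j \<and> Suc j < length xs \<and> xs ! i < xs ! j \<and> xs ! i < xs ! Suc j
        \<longrightarrow> Q (xs ! j) (xs ! Suc j))"
proof (induction xs)
  case (Cons x xs)
  let ?P = "\<lambda>xs i j. i < j \<and> Suc j < length xs \<and> xs ! i < xs ! j \<and> xs ! i < xs ! Suc j
        \<longrightarrow> Q (xs ! j) (xs ! Suc j)"
  \<comment> \<open>The case \<open>j = 0\<close> is vacuous because \<open>i < j\<close>, so
    \<open>j\<close> may be taken as a successor.\<close>
  have split_first: "(\<forall>i j. R i j) \<longleftrightarrow> (\<forall>j. R 0 (Suc j)) \<and> (\<forall>i j. R (Suc i) (Suc j))"
    if "\<And>i. R i 0" for R :: "nat \<Rightarrow> nat \<Rightarrow> bool"
    using that by (metis not0_implies_Suc)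
  have "(\<forall>i j. ?P (x # xs) i j) \<longleftrightarrow> (\<forall>j. ?P (x # xs) 0 (Suc j)) \<and> (\<forall>i j. ?P (x # xs) (Suc i) (Suc j))"
    by (rule split_first) simp
  also have "\<dots> \<longleftrightarrow> successively (\<lambda>y z. x < y \<longrightarrow> x < z \<longrightarrow> Q y z) xs \<and> (\<forall>i j. ?P xs i j)"
    by (auto simp: successively_conv_nth)
  finally show ?case
    using Cons.IH by simp
qed simp

lemma all_less_3: "(\<forall>i<Suc (Suc (Suc 0)). P i) \<longleftrightarrow> P 0 \<and> P (Suc 0) \<and> P (Suc (Suc 0))"
  by (auto simp: less_Suc_eq)

text \<open>An occurrence is brought to the shape shared by both patterns: two adjacent letters
  above \<open>a\<close> that violate \<open>Q\<close>.\<close>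

lemma not_contains_gen_123: "\<not> contains_gen [1, 2, 3] xs \<longleftrightarrow> avoids (\<ge>) xs"
proof -
  have "order_isomorphic [a, b, c] [1, 2, 3] \<longleftrightarrow> a < b \<and> a < c \<and> \<not> c \<le> b" for a b c
    by (auto simp: order_isomorphic_def all_less_3)
  then show ?thesis
    unfolding contains_gen_def avoids_iff_nth by blast
qed

lemma not_contains_gen_132: "\<not> contains_gen [1, 3, 2] xs \<longleftrightarrow> avoids (\<le>) xs"
proof -
  have "order_isomorphic [a, b, c] [1, 3, 2] \<longleftrightarrow> a < b \<and> a < c \<and> \<not> b \<le> c" for a b c
    by (auto simp: order_isomorphic_def all_less_3)
  then show ?thesis
    unfolding contains_gen_def avoids_iff_nth by blast
qed

lemma avoids_of_successively: "successively Q xs \<Longrightarrow> avoids Q xs"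
  by (induction xs) (auto simp: successively_Cons intro: successively_mono)

text \<open>No letter exceeds one to its left, so the condition is vacuous whatever \<open>Q\<close>
  is.\<close>

lemma avoids_of_decreasing: "sorted_wrt (>) xs \<Longrightarrow> avoids Q xs"
proof (induction xs)
  case (Cons x xs)
  then show ?case
    by (auto simp: successively_conv_nth dest!: nth_mem)
qed simp

text \<open>As a first letter of occurrences, \<open>m\<close> lies below all of \<open>t\<close>
  and forces \<open>Q\<close> there; this in turn settles the condition on \<open>t\<close> for all
  other first letters.\<close>

lemma avoids_append_min:
  assumes "\<forall>x \<in> set s \<union> set t. m < x"
  shows "avoids Q (s @ m # t) \<longleftrightarrow> avoids Q s \<and> successively Q t"
  using assms
proof (induction s)
  case Nil
  have "successively (\<lambda>y z. m < y \<longrightarrow> m < z \<longrightarrow> Q y z) t \<longleftrightarrow> successively Q t"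
    using Nil by (intro successively_cong) auto
  then show ?case
    by (auto intro: avoids_of_successively)
next
  case (Cons x s)
  let ?P = "\<lambda>y z. x < y \<longrightarrow> x < z \<longrightarrow> Q y z"
  \<comment> \<open>A pair of adjacent letters containing \<open>m\<close> meets \<open>?P\<close>
    trivially since \<open>m < x\<close>, so \<open>m\<close> cuts the chain in two.\<close>
  have "successively ?P (s @ m # t) \<longleftrightarrow> successively ?P s \<and> successively ?P t"
    using Cons.prems by (auto simp: successively_append_iff successively_Cons)
  moreover have "successively Q t \<Longrightarrow> successively ?P t"
    by (auto intro: successively_mono)
  ultimately show ?case
    using Cons by auto
qed

section \<open>Decreasing initial segments\<close>

lemma order_isomorphic_decreasing:
  "order_isomorphic xs (rev [1..<Suc k]) \<longleftrightarrow> length xs = k \<and> sorted_wrt (>) xs"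
proof -
  have "(\<forall>i<k. \<forall>j<k. xs ! i < xs ! j \<longleftrightarrow> rev [1..<Suc k] ! i < rev [1..<Suc k] ! j)
          \<longleftrightarrow> sorted_wrt (>) xs"
    if k: "length xs = k"
  proof -
    have *: "rev [1..<Suc k] ! i < rev [1..<Suc k] ! j \<longleftrightarrow> j < i" if "i < k" "j < k" for i j
      using that by (auto simp: rev_nth simp del: upt_Suc)
    have "xs ! i < xs ! j \<longleftrightarrow> j < i" if "sorted_wrt (>) xs" "i < k" "j < k" for i j
      using that k sorted_wrt_nth_less[OF that(1), of i j] sorted_wrt_nth_less[OF that(1), of j i]
      by (cases i j rule: linorder_cases) auto
    moreover have "sorted_wrt (>) xs" if "\<forall>i<k. \<forall>j<k. xs ! i < xs ! j \<longleftrightarrow> j < i"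
      using that k by (auto simp: sorted_wrt_iff_nth_less)
    ultimately show ?thesis
      using * by meson
  qed
  then show ?thesis
    by (auto simp: order_isomorphic_def simp del: upt_Suc)
qed

definition starts_decreasing :: "nat \<Rightarrow> nat list \<Rightarrow> bool" where
  "starts_decreasing k xs \<longleftrightarrow> k \<le> length xs \<and> sorted_wrt (>) (take k xs)"

lemma begins_with_decreasing:
  "begins_with (rev [1..<Suc k]) xs \<longleftrightarrow> starts_decreasing k xs \<or> (xs = [] \<and> k = 1)"
proof -
  have "rev [1..<Suc k] = [1] \<longleftrightarrow> k = 1"
    by (cases k) (auto dest: arg_cong[of _ _ length])
  then show ?thesis
    unfolding begins_with_def order_isomorphic_decreasing starts_decreasing_def
    by (auto simp del: upt_Suc)
qed

text \<open>The prefix of length \<open>k\<close> lies inside \<open>s\<close>, or ends exactly at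
  \<open>m\<close>, or would have to pass \<open>m\<close> and so contain an ascent.\<close>

lemma starts_decreasing_append_min:
  assumes "\<forall>x \<in> set s \<union> set t. m < x" "k \<ge> 1"
  shows "starts_decreasing k (s @ m # t) \<longleftrightarrow>
           starts_decreasing k s \<or> (length s = k - 1 \<and> sorted_wrt (>) s)"
proof (cases "k \<le> length s")
  case True
  then show ?thesis
    using assms by (auto simp: starts_decreasing_def)
next
  case False
  show ?thesis
  proof (cases "length s = k - 1")
    case True
    then have "take k (s @ m # t) = s @ [m]"
      using assms by (cases k) auto
    then show ?thesis
      using assms True by (auto simp: starts_decreasing_def sorted_wrt_append)
  next
    case neq: False
    \<comment> \<open>At least two letters are missing after \<open>s\<close>: either the word is
      too short, or the prefix contains \<open>m\<close> followed by a larger letter.\<close>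
    then obtain d where d: "k - length s = Suc (Suc d)"
      using False by (intro that[of "k - length s - 2"]) (use assms in arith)
    have "\<not> starts_decreasing k (s @ m # t)"
    proof (cases t)
      case Nil
      then show ?thesis
        using d by (auto simp: starts_decreasing_def)
    next
      case (Cons y t')
      then show ?thesis
        using d assms False by (auto simp: starts_decreasing_def sorted_wrt_append)
    qed
    then show ?thesis
      using False neq by (auto simp: starts_decreasing_def)
  qed
qed

section \<open>Monotone arrangements of a finite set\<close>

lemma card_increasing_permutations:
  fixes T :: "nat set"
  assumes "finite T"
  shows "card {xs \<in> permutations_of_set T. sorted_wrt (\<le>) xs} = 1"
proof -
  have "{xs \<in> permutations_of_set T. sorted_wrt (\<le>) xs} = {sorted_list_of_set T}"
    using assms by (auto simp: permutations_of_set_def sorted_list_of_set.idem_if_sorted_distinct)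
  then show ?thesis
    by simp
qed

lemma sorted_wrt_rev_permutations:
  "{xs \<in> permutations_of_set T. sorted_wrt (\<lambda>x y. Q y x) xs}
     = rev ` {xs \<in> permutations_of_set T. sorted_wrt Q xs}"
proof (intro equalityI subsetI)
  fix xs assume "xs \<in> {xs \<in> permutations_of_set T. sorted_wrt (\<lambda>x y. Q y x) xs}"
  then show "xs \<in> rev ` {xs \<in> permutations_of_set T. sorted_wrt Q xs}"
    by (intro image_eqI[of _ _ "rev xs"]) (auto simp: permutations_of_set_def sorted_wrt_rev)
qed (auto simp: permutations_of_set_def sorted_wrt_rev)

lemma card_decreasing_permutations:
  fixes T :: "nat set"
  assumes "finite T"
  shows "card {xs \<in> permutations_of_set T. sorted_wrt (\<ge>) xs} = 1"
  unfolding sorted_wrt_rev_permutations[of T "(\<le>)"]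
  using card_increasing_permutations[OF assms] by (simp add: card_image inj_on_def)

text \<open>Prefixes are compared strictly but \<open>Q\<close> is weak; distinctness of the letters
  reconciles the two.\<close>

lemma card_strictly_decreasing_permutations:
  fixes T :: "nat set"
  assumes "finite T"
  shows "card {xs \<in> permutations_of_set T. sorted_wrt (>) xs} = 1"
proof -
  have "sorted_wrt (>) xs \<longleftrightarrow> sorted_wrt (\<ge>) xs" if "distinct xs" for xs :: "nat list"
    using that by (auto simp: sorted_wrt_iff_nth_less nth_eq_iff_index_eq order_less_le)
  then have "{xs \<in> permutations_of_set T. sorted_wrt (>) xs}
      = {xs \<in> permutations_of_set T. sorted_wrt (\<ge>) xs}"
    by (intro Collect_cong conj_cong refl) (auto simp only: permutations_of_set_def)
  then show ?thesis
    using card_decreasing_permutations[OF assms] by simp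
qed

section \<open>Recursion by splitting at the minimum\<close>

definition class_perms :: "(nat \<Rightarrow> nat \<Rightarrow> bool) \<Rightarrow> nat \<Rightarrow> nat set \<Rightarrow> nat list set" where
  "class_perms Q k S = {xs \<in> permutations_of_set S. avoids Q xs \<and> starts_decreasing k xs}"

lemma finite_class_perms [simp]: "finite (class_perms Q k S)"
  by (simp add: class_perms_def)

lemma append_min_eq_iff:
  assumes "m \<notin> set s" "m \<notin> set s'"
  shows "s @ m # t = s' @ m # t' \<longleftrightarrow> s = s' \<and> t = t'"
  using assms
proof (induction s arbitrary: s')
  case Nil
  then show ?case by (cases s') auto
next
  case (Cons a s)
  then show ?case by (cases s') auto
qed

text \<open>Here \<open>U\<close> is the set of letters before \<open>m\<close>. The letters after
  \<open>m\<close> have a single \<open>Q\<close>-sorted arrangement, and \<open>of_bool\<close>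
  counts the decreasing left part of length \<open>k - 1\<close> that \<open>m\<close>
  completes.\<close>

lemma card_class_perms_rec:
  assumes Q: "Q = (\<le>) \<or> Q = (\<ge>)" and k: "k \<ge> 1"
    and S: "finite V" "\<forall>x \<in> V. m < x"
  shows "card (class_perms Q k (insert m V))
    = (\<Sum>U \<in> Pow V. card (class_perms Q k U) + of_bool (card U = k - 1))"
proof -
  \<comment> \<open>\<open>B U\<close> collects the admissible left parts and \<open>D\<close> the
    admissible right parts.\<close>
  define B where "B U = class_perms Q k U \<union>
      {xs \<in> permutations_of_set U. card U = k - 1 \<and> sorted_wrt (>) xs}" for U
  define D where "D T = {xs \<in> permutations_of_set T. sorted_wrt Q xs}" for T
  have succ: "successively Q t \<longleftrightarrow> sorted_wrt Q t" for t
    using Q by (intro successively_conv_sorted_wrt) (auto simp: transp_def)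
  have "m \<notin> V"
    using S by auto
  have len: "length s = card U" if "s \<in> permutations_of_set U" for s U
    using that by (auto simp: permutations_of_set_def distinct_card)
  have split: "s @ m # t \<in> class_perms Q k (insert m V) \<longleftrightarrow>
      s \<in> B U \<and> t \<in> D (V - U)"
    if "s \<in> permutations_of_set U" "t \<in> permutations_of_set (V - U)" "U \<subseteq> V" for s t U
  proof -
    have *: "\<forall>x \<in> set s \<union> set t. m < x"
      using that S by (auto simp: permutations_of_set_def)
    have "s @ m # t \<in> permutations_of_set (insert m V)"
      using that \<open>m \<notin> V\<close> by (auto simp: permutations_of_set_def)
    then show ?thesis
      using that len[OF that(1)]
      by (auto simp: class_perms_def B_def D_def avoids_append_min[OF *] succ
          starts_decreasing_append_min[OF * k] avoids_of_decreasing)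
  qed
  have "bij_betw (\<lambda>(U, s, t). s @ m # t) (SIGMA U : Pow V. B U \<times> D (V - U))
      (class_perms Q k (insert m V))"
  proof (intro bij_betwI')
    fix p q assume pq: "p \<in> (SIGMA U : Pow V. B U \<times> D (V - U))"
      "q \<in> (SIGMA U : Pow V. B U \<times> D (V - U))"
    obtain U s t U' s' t' where eq: "p = (U, s, t)" "q = (U', s', t')"
      by (metis prod_cases3)
    have "set s = U" "set s' = U'" "U \<subseteq> V" "U' \<subseteq> V"
      using pq eq by (auto simp: B_def class_perms_def permutations_of_set_def)
    moreover from this have "m \<notin> set s" "m \<notin> set s'"
      using \<open>m \<notin> V\<close> by auto
    ultimately show "(case p of (U, s, t) \<Rightarrow> s @ m # t) = (case q of (U, s, t) \<Rightarrow> s @ m # t) \<longleftrightarrow> p = q"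
      unfolding eq using append_min_eq_iff[of m s s' t t'] by auto
  next
    fix p assume "p \<in> (SIGMA U : Pow V. B U \<times> D (V - U))"
    then obtain U s t where p: "p = (U, s, t)" "U \<subseteq> V" "s \<in> B U" "t \<in> D (V - U)"
      by auto
    then have "s \<in> permutations_of_set U" "t \<in> permutations_of_set (V - U)"
      by (auto simp: B_def D_def class_perms_def)
    then show "(case p of (U, s, t) \<Rightarrow> s @ m # t) \<in> class_perms Q k (insert m V)"
      using split p by simp
  next
    fix xs assume xs: "xs \<in> class_perms Q k (insert m V)"
    then have "distinct xs" "set xs = insert m V"
      by (auto simp: class_perms_def permutations_of_set_def)
    then obtain s t where st: "xs = s @ m # t"
      by (metis insertI1 split_list)
    with \<open>distinct xs\<close> \<open>set xs = insert m V\<close> have "set s \<subseteq> V" "V - set s = set t" "distinct s" "distinct t"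
      using \<open>m \<notin> V\<close> by auto
    then show "\<exists>p \<in> (SIGMA U : Pow V. B U \<times> D (V - U)). xs = (case p of (U, s, t) \<Rightarrow> s @ m # t)"
      using split[of s "set s" t] xs st
      by (intro bexI[of _ "(set s, s, t)"]) (auto simp: permutations_of_set_def)
  qed
  then have "card (class_perms Q k (insert m V)) = card (SIGMA U : Pow V. B U \<times> D (V - U))"
    by (simp add: bij_betw_same_card)
  also have "\<dots> = (\<Sum>U \<in> Pow V. card (B U) * card (D (V - U)))"
    using S by (subst card_SigmaI) (auto simp: B_def D_def card_cartesian_product)
  also have "\<dots> = (\<Sum>U \<in> Pow V. card (class_perms Q k U) + of_bool (card U = k - 1))"
  proof (intro sum.cong refl)
    fix U assume "U \<in> Pow V"
    then have "finite U" "finite (V - U)"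
      using S by (auto intro: finite_subset)
    have "card (D (V - U)) = 1"
      unfolding D_def
      using Q card_increasing_permutations[OF \<open>finite (V - U)\<close>]
        card_decreasing_permutations[OF \<open>finite (V - U)\<close>] by auto
    \<comment> \<open>The union is disjoint by length: at least \<open>k\<close> in the first set,
      exactly \<open>k - 1\<close> in the second.\<close>
    moreover have "card (B U) = card (class_perms Q k U)
        + card {xs \<in> permutations_of_set U. card U = k - 1 \<and> sorted_wrt (>) xs}"
      unfolding B_def using k
      by (intro card_Un_disjoint) (auto simp: class_perms_def starts_decreasing_def dest: len)
    moreover have "card {xs \<in> permutations_of_set U. card U = k - 1 \<and> sorted_wrt (>) xs}
        = of_bool (card U = k - 1)"
      using card_strictly_decreasing_permutations[OF \<open>finite U\<close>] by auto
    ultimately show "card (B U) * card (D (V - U))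
        = card (class_perms Q k U) + of_bool (card U = k - 1)"
      by simp
  qed
  finally show ?thesis .
qed

lemma sum_Pow_card:
  fixes f :: "nat \<Rightarrow> nat"
  assumes "finite V"
  shows "(\<Sum>U \<in> Pow V. f (card U)) = (\<Sum>j\<le>card V. (card V choose j) * f j)"
proof -
  have "(\<Sum>U \<in> Pow V. f (card U)) = (\<Sum>j\<le>card V. \<Sum>U \<in> {U \<in> Pow V. card U = j}. f (card U))"
    using assms by (intro sum.group[symmetric]) (auto intro: card_mono)
  also have "\<dots> = (\<Sum>j\<le>card V. (card V choose j) * f j)"
    using n_subsets[OF assms] by (intro sum.cong) auto
  finally show ?thesis .
qed

text \<open>Left parts use arbitrary sets of letters, so the count must depend on size only. Strong
  induction replaces relabelling: the recursion at the minimum involves only smaller sets.\<close>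

lemma card_class_perms_rec_card:
  assumes Q: "Q = (\<le>) \<or> Q = (\<ge>)" and k: "k \<ge> 1" and "finite S"
  shows "card (class_perms Q k S) = card (class_perms Q k {1..card S})"
  using \<open>finite S\<close>
proof (induction "card S" arbitrary: S rule: less_induct)
  case less
  define c where "c j = card (class_perms Q k {1..j}) + of_bool (j = k - 1)" for j
  \<comment> \<open>The right side mentions only \<open>card S\<close>, so it serves both
    \<open>S\<close> and \<open>{1..card S}\<close>.\<close>
  have step: "card (class_perms Q k T) = (\<Sum>j\<le>card S - 1. (card S - 1 choose j) * c j)"
    if T: "finite T" "T \<noteq> {}" "card T = card S" for T
  proof -
    let ?V = "T - {Min T}"
    have "card (class_perms Q k T) = card (class_perms Q k (insert (Min T) ?V))"
      using T by (simp add: insert_absorb)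
    also have "\<dots> = (\<Sum>U \<in> Pow ?V. card (class_perms Q k U) + of_bool (card U = k - 1))"
      using T by (intro card_class_perms_rec Q k) (auto simp: order_less_le)
    also have "\<dots> = (\<Sum>U \<in> Pow ?V. c (card U))"
    proof (intro sum.cong refl)
      fix U assume "U \<in> Pow ?V"
      then have "U \<subset> T"
        using T Min_in[of T] by blast
      then have "finite U"
        using T by (auto intro: finite_subset)
      have "card U < card S"
        using psubset_card_mono[OF T(1) \<open>U \<subset> T\<close>] T(3) by simp
      then show "card (class_perms Q k U) + of_bool (card U = k - 1) = c (card U)"
        using less.hyps[of U] \<open>finite U\<close> by (simp add: c_def)
    qed
    also have "\<dots> = (\<Sum>j\<le>card ?V. (card ?V choose j) * c j)"
      using T by (intro sum_Pow_card) auto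
    finally show ?thesis
      using T by simp
  qed
  show ?case
  proof (cases "S = {}")
    case False
    then have "card S > 0"
      using less.prems by (simp add: card_gt_0_iff)
    then show ?thesis
      using step[of S] step[of "{1..card S}"] less.prems False by simp
  qed simp
qed

lemma card_class_perms_Suc:
  assumes Q: "Q = (\<le>) \<or> Q = (\<ge>)" and k: "k \<ge> 1"
  shows "card (class_perms Q k {1..Suc n})
    = (\<Sum>j\<le>n. (n choose j) * (card (class_perms Q k {1..j}) + of_bool (j = k - 1)))"
proof -
  have "{1..Suc n} = insert 1 {2..Suc n}"
    by auto
  then have "card (class_perms Q k {1..Suc n})
      = (\<Sum>U \<in> Pow {2..Suc n}. card (class_perms Q k U) + of_bool (card U = k - 1))"
    using card_class_perms_rec[OF Q k, of "{2..Suc n}" 1] by auto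
  also have "\<dots> = (\<Sum>U \<in> Pow {2..Suc n}.
      card (class_perms Q k {1..card U}) + of_bool (card U = k - 1))"
    by (intro sum.cong refl arg_cong2[where f = "(+)"] card_class_perms_rec_card[OF Q k])
      (auto intro: finite_subset)
  also have "\<dots> = (\<Sum>j\<le>n. (n choose j) * (card (class_perms Q k {1..j}) + of_bool (j = k - 1)))"
    using sum_Pow_card[of "{2..Suc n}" "\<lambda>j. card (class_perms Q k {1..j}) + of_bool (j = k - 1)"]
    by simp
  finally show ?thesis .
qed

section \<open>Generating functions and the differential equation\<close>

definition class_egf :: "(nat \<Rightarrow> nat \<Rightarrow> bool) \<Rightarrow> nat \<Rightarrow> real fps" where
  "class_egf Q k = Abs_fps (\<lambda>n. real (card (class_perms Q k {1..n})) / fact n)"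

lemma class_egf_0: "k \<ge> 1 \<Longrightarrow> fps_nth (class_egf Q k) 0 = 0"
  by (auto simp: class_egf_def class_perms_def starts_decreasing_def)

text \<open>The recursion is a binomial convolution with the constant sequence 1, whose exponential
  generating function is \<open>fps_exp 1\<close>; the indicator of \<open>j = k - 1\<close>
  contributes the monomial.\<close>

lemma fps_deriv_class_egf:
  assumes Q: "Q = (\<le>) \<or> Q = (\<ge>)" and k: "k \<ge> 1"
  shows "fps_deriv (class_egf Q k)
    = fps_exp 1 * (class_egf Q k + fps_const (1 / fact (k - 1)) * fps_X ^ (k - 1))"
proof (rule fps_ext)
  fix n
  define c where "c j = real (card (class_perms Q k {1..j}) + of_bool (j = k - 1))" for j
  have nth: "fps_nth (class_egf Q k + fps_const (1 / fact (k - 1)) * fps_X ^ (k - 1)) j = c j / fact j" for j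
    by (auto simp: class_egf_def c_def fps_X_power_nth add_divide_distrib)
  have "fps_nth (fps_deriv (class_egf Q k)) n = real (card (class_perms Q k {1..Suc n})) / fact n"
    by (simp add: class_egf_def field_simps del: of_nat_Suc)
  also have "\<dots> = (\<Sum>j\<le>n. real (n choose j) * c j / fact n)"
    unfolding card_class_perms_Suc[OF Q k]
    by (simp add: c_def sum_divide_distrib)
  also have "\<dots> = (\<Sum>j\<le>n. c j / fact j * (1 / fact (n - j)))"
    by (intro sum.cong refl) (simp add: binomial_fact)
  also have "\<dots> = fps_nth ((class_egf Q k + fps_const (1 / fact (k - 1)) * fps_X ^ (k - 1)) * fps_exp 1) n"
    unfolding fps_mult_nth nth atLeast0AtMost by simp
  finally show "fps_nth (fps_deriv (class_egf Q k)) n = fps_nth (fps_exp 1 *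
      (class_egf Q k + fps_const (1 / fact (k - 1)) * fps_X ^ (k - 1))) n"
    by (simp add: mult.commute)
qed

lemma exp_fps_const: "exp_fps (fps_const c) = fps_const (exp c)"
  by (simp add: exp_fps_def)

lemma exp_fps_uminus: "exp_fps F * exp_fps (- F) = 1"
  using exp_fps_add[of F "- F"] exp_fps_const[of 0] by simp

lemma fps_integral0_deriv:
  fixes F :: "real fps"
  assumes "fps_nth F 0 = 0"
  shows "fps_integral0 (fps_deriv F) = F"
proof (rule fps_ext)
  show "fps_nth (fps_integral0 (fps_deriv F)) n = fps_nth F n" for n
    using assms by (cases n) (auto simp: fps_integral_def)
qed

lemma class_egf_eq:
  assumes Q: "Q = (\<le>) \<or> Q = (\<ge>)" and k: "k \<ge> 1"
  shows "class_egf Q k = fps_const (1 / fact (k - 1)) * exp_fps (fps_exp 1) *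
           fps_integral0 (fps_X ^ (k - 1) * exp_fps (- fps_exp 1 + fps_X))"
proof -
  let ?G = "class_egf Q k" and ?I = "exp_fps (- fps_exp 1)" and ?c = "fps_const (1 / fact (k - 1)) :: real fps"
  \<comment> \<open>The integrating factor \<open>?I\<close> cancels the term containing
    \<open>?G\<close>.\<close>
  have "fps_deriv (?I * ?G) = ?c * (fps_X ^ (k - 1) * exp_fps (- fps_exp 1 + fps_X))"
    unfolding exp_fps_add exp_fps_X
    by (simp add: fps_deriv_exp_fps fps_deriv_class_egf[OF Q k] algebra_simps)
  then have "?I * ?G = ?c * fps_integral0 (fps_X ^ (k - 1) * exp_fps (- fps_exp 1 + fps_X))"
    using fps_integral0_deriv[of "?I * ?G"] class_egf_0[OF k]
    by (simp add: fps_integral0_fps_const_mult_left)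
  moreover have "?G = exp_fps (fps_exp 1) * (?I * ?G)"
    using exp_fps_uminus[of "fps_exp 1"] by (simp flip: mult.assoc)
  ultimately show ?thesis
    by (simp add: mult_ac)
qed

text \<open>For \<open>k = 1\<close> the monomial is 1 and the equation is homogeneous in
  \<open>1 + ?G\<close>, so \<open>?I * (1 + ?G)\<close> is constant.\<close>

lemma class_egf_1:
  assumes Q: "Q = (\<le>) \<or> Q = (\<ge>)"
  shows "1 + class_egf Q 1 = exp_fps (fps_exp 1 - 1)"
proof -
  let ?G = "class_egf Q 1" and ?I = "exp_fps (- fps_exp 1)"
  have "fps_deriv (?I * (1 + ?G)) = 0"
    using fps_deriv_class_egf[OF Q, of 1] by (simp add: fps_deriv_exp_fps algebra_simps)
  \<comment> \<open>The constant is the value at 0, where \<open>- fps_exp 1\<close> is -1 and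
    \<open>?G\<close> vanishes.\<close>
  then have "?I * (1 + ?G) = fps_const (exp (- 1))"
    using fps_deriv_eq_0_iff[of "?I * (1 + ?G)"] class_egf_0[of 1 Q]
    by (simp add: exp_fps_nth_0)
  moreover have "1 + ?G = exp_fps (fps_exp 1) * (?I * (1 + ?G))"
    using exp_fps_uminus[of "fps_exp 1"] by (simp flip: mult.assoc)
  ultimately have "1 + ?G = exp_fps (fps_exp 1) * exp_fps (fps_const (- 1))"
    by (simp add: exp_fps_const)
  also have "\<dots> = exp_fps (fps_exp 1 - 1)"
    unfolding exp_fps_add[symmetric] by (simp flip: fps_const_neg)
  finally show ?thesis .
qed

text \<open>For \<open>k = 1\<close> the empty word is not in \<open>class_perms\<close>; the
  convention adds it at \<open>n = 0\<close>, which raises the constant term by 1.\<close>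

lemma egf_avoiding_eq:
  assumes Q: "\<And>xs. \<not> contains_gen q xs \<longleftrightarrow> avoids Q xs"
  shows "egf_avoiding (rev [1..<Suc k]) q = of_bool (k = 1) + class_egf Q k"
proof (rule fps_ext)
  fix n
  have "{xs \<in> permutations_of_set {1..n}. \<not> contains_gen q xs \<and> begins_with (rev [1..<Suc k]) xs}
      = class_perms Q k {1..n} \<union> {xs. xs = [] \<and> n = 0 \<and> k = 1}"
    unfolding Q begins_with_decreasing
    by (auto simp: class_perms_def permutations_of_set_def)
  moreover have "card (class_perms Q k {1..n} \<union> {xs. xs = [] \<and> n = 0 \<and> k = 1})
      = card (class_perms Q k {1..n}) + card {xs :: nat list. xs = [] \<and> n = 0 \<and> k = 1}"
    by (intro card_Un_disjoint) (auto simp: class_perms_def starts_decreasing_def)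
  moreover have "card {xs :: nat list. xs = [] \<and> n = 0 \<and> k = 1} = of_bool (n = 0 \<and> k = 1)"
    by auto
  ultimately have "num_avoiding (rev [1..<Suc k]) q n
      = card (class_perms Q k {1..n}) + of_bool (n = 0 \<and> k = 1)"
    unfolding num_avoiding_def by simp
  then show "fps_nth (egf_avoiding (rev [1..<Suc k]) q) n = fps_nth (of_bool (k = 1) + class_egf Q k) n"
    by (auto simp: egf_avoiding_def class_egf_def simp del: upt_Suc)
qed

text \<open>The two patterns differ only in the choice of \<open>Q\<close>, and the solution of the
  differential equation is the same for both choices.\<close>

theorem proposition4:
  fixes k :: nat
  assumes "k \<ge> 1"
  shows "egf_avoiding (rev [1..<Suc k]) [1, 2, 3] = egf_avoiding (rev [1..<Suc k]) [1, 3, 2] \<and>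
    egf_avoiding (rev [1..<Suc k]) [1, 3, 2] =
      (if k \<ge> 2 then
         fps_const (1 / fact (k - 1)) * exp_fps (fps_exp 1) *
           fps_integral0 (fps_X ^ (k - 1) * exp_fps (- fps_exp 1 + fps_X))
       else exp_fps (fps_exp 1 - 1))"
proof (cases "k = 1")
  case True
  then show ?thesis
    using egf_avoiding_eq[OF not_contains_gen_123, of k] egf_avoiding_eq[OF not_contains_gen_132, of k]
      class_egf_1[of "(\<le>)"] class_egf_1[of "(\<ge>)"]
    by (simp del: upt_Suc)
next
  case False
  then show ?thesis
    using assms egf_avoiding_eq[OF not_contains_gen_123, of k] egf_avoiding_eq[OF not_contains_gen_132, of k]
      class_egf_eq[of "(\<le>)" k] class_egf_eq[of "(\<ge>)" k]
    by (simp del: upt_Suc)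
qed

end
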